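(* The spaces $\mathrm{(cfid)}$, $\mathrm{(cid)}$, $\mathrm{(pfd)}$, and $\mathrm{(rid)}$, with the topology induced by the interleaving distance $d_I$, are not separable. The same is true for the subspace of $\mathrm{(cid)}$ consisting of modules with finite interleaving distance to the zero module (which equals the subspace of $\mathrm{(cfid)}$ consisting of modules with finite interleaving distance to the zero module), and for $\mathrm{(cid)}\cap\mathrm{(qtame)}$ and $\mathrm{(cfid)}\cap\mathrm{(qtame)}$.
   Context: Fix a field $\mathbf{k}$. A persistence module is a functor $M:(\mathbb{R},\le)\to \mathrm{Vect}_{\mathbf{k}}$; "persistence module" means isomorphism class. For an interval $J\subset\mathbb{R}$, the interval module $J$ is $\mathbf{k}$ at points of $J$ and $0$ elsewhere, with identity maps between points of $J$ and zero maps otherwise. For $\varepsilon\ge 0$, $M,N$ are $\varepsilon$-interleaved if there are families of linear maps $\varphi_a:M(a)\to N(a+\varepsilon)$ and $\psi_a:N(a)\to M(a+\varepsilon)$, natural in $a\in\mathbb{R}$, with $\psi_{a+\varepsilon}\varphi_a=M(a\le a+2\varepsilon)$ and $\varphi_{a+\varepsilon}\psi_a=N(a\le a+2\varepsilon)$ for all $a$. The interleaving distance is $d_I(M,N)=\inf\{\varepsilon\ge0 : M,N \text{ are } \varepsilon\text{-interleaved}\}$ ($\infty$ if there is none). It is an extended pseudometric; the induced topology has the open balls $B_r(M)=\{N: d_I(M,N)<r\}$, $r>0$, as a base. Collections of persistence modules: $\mathrm{(cid)}$: direct sums of countably many interval modules; $\mathrm{(cfid)}$: those in $\mathrm{(cid)}$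 with all intervals finite (bounded); $\mathrm{(pfd)}$: persistence modules $M$ with every $M(a)$ finite dimensional; $\mathrm{(rid)}$: direct sums $\bigoplus_{\alpha\in A}I_\alpha$ of interval modules with $|A|\le|\mathbb{R}|$; $\mathrm{(qtame)}$: persistence modules $M$ with $M(a<b)$ of finite rank for all $a<b$. Separable means having a countable dense subset. *)

theory Defs
  imports "HOL-Analysis.Analysis" "HOL-Library.Poly_Mapping"
begin

section \<open>Persistence modules\<close>

text \<open>
  The vector spaces of a persistence module are linear subspaces of one ambient vector space,
  which is given by its scalar multiplication \<open>s\<close> on a type. Values of \<open>struct M a b\<close> outside
  \<open>obj M a\<close>, or for \<open>a > b\<close>, carry no meaning; no notion below depends on them.
\<close>

record 'v pmod =
  obj :: "real \<Rightarrow> 'v set"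
  struct :: "real \<Rightarrow> real \<Rightarrow> 'v \<Rightarrow> 'v"

definition linear_between ::
    "('k \<Rightarrow> 'v::ab_group_add \<Rightarrow> 'v) \<Rightarrow> ('k \<Rightarrow> 'w::ab_group_add \<Rightarrow> 'w)
      \<Rightarrow> 'v set \<Rightarrow> 'w set \<Rightarrow> ('v \<Rightarrow> 'w) \<Rightarrow> bool" where
  "linear_between s s' V W f \<longleftrightarrow>
     f \<in> V \<rightarrow> W \<and>
     (\<forall>x\<in>V. \<forall>y\<in>V. f (x + y) = f x + f y) \<and>
     (\<forall>c. \<forall>x\<in>V. f (s c x) = s' c (f x))"

definition persistence_module ::
    "('k::field \<Rightarrow> 'v::ab_group_add \<Rightarrow> 'v) \<Rightarrow> 'v pmod \<Rightarrow> bool" where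
  "persistence_module s M \<longleftrightarrow>
     vector_space s \<and>
     (\<forall>a. module.subspace s (obj M a)) \<and>
     (\<forall>a b. a \<le> b \<longrightarrow> linear_between s s (obj M a) (obj M b) (struct M a b)) \<and>
     (\<forall>a. \<forall>x\<in>obj M a. struct M a a x = x) \<and>
     (\<forall>a b c. a \<le> b \<longrightarrow> b \<le> c \<longrightarrow>
        (\<forall>x\<in>obj M a. struct M b c (struct M a b x) = struct M a c x))"

definition isomorphic ::
    "('k \<Rightarrow> 'v::ab_group_add \<Rightarrow> 'v) \<Rightarrow> 'v pmod
      \<Rightarrow> ('k \<Rightarrow> 'w::ab_group_add \<Rightarrow> 'w) \<Rightarrow> 'w pmod \<Rightarrow> bool" where
  "isomorphic s M s' N \<longleftrightarrow>
     (\<exists>\<phi>. (\<forall>a. linear_between s s' (obj M a) (obj N a) (\<phi> a) \<and>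
               bij_betw (\<phi> a) (obj M a) (obj N a)) \<and>
          (\<forall>a b. a \<le> b \<longrightarrow>
             (\<forall>x\<in>obj M a. \<phi> b (struct M a b x) = struct N a b (\<phi> a x))))"

definition zero_pmod :: "'v::zero pmod" where
  "zero_pmod = \<lparr>obj = (\<lambda>a. {0}), struct = (\<lambda>a b x. 0)\<rparr>"

text \<open>The ambient space is the field itself, with scalar multiplication \<open>(*)\<close>.\<close>

definition interval_pmod :: "real set \<Rightarrow> 'k::field pmod" where
  "interval_pmod J =
     \<lparr>obj = (\<lambda>a. if a \<in> J then UNIV else {0}),
      struct = (\<lambda>a b x. if a \<in> J \<and> b \<in> J then x else 0)\<rparr>"

text \<open>
  The elements of a direct sum are families of finite support, so its ambient space is
  \<open>'i \<Rightarrow>\<^sub>0 'v\<close> with the pointwise scalar multiplication \<open>fs_scale s\<close>.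
\<close>

definition fs_scale :: "('k \<Rightarrow> 'v::zero \<Rightarrow> 'v) \<Rightarrow> 'k \<Rightarrow> ('i \<Rightarrow>\<^sub>0 'v) \<Rightarrow> ('i \<Rightarrow>\<^sub>0 'v)" where
  "fs_scale s c f = Poly_Mapping.map (s c) f"

definition direct_sum :: "'i set \<Rightarrow> ('i \<Rightarrow> 'v::zero pmod) \<Rightarrow> ('i \<Rightarrow>\<^sub>0 'v) pmod" where
  "direct_sum A M =
     \<lparr>obj = (\<lambda>a. {f. Poly_Mapping.keys f \<subseteq> A \<and>
                     (\<forall>i\<in>A. Poly_Mapping.lookup f i \<in> obj (M i) a)}),
      struct = (\<lambda>a b. Poly_Mapping.mapp (\<lambda>i. struct (M i) a b))\<rparr>"

section \<open>The interleaving distance\<close>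

definition interleaved ::
    "('k \<Rightarrow> 'v::ab_group_add \<Rightarrow> 'v) \<Rightarrow> real \<Rightarrow> 'v pmod \<Rightarrow> 'v pmod \<Rightarrow> bool" where
  "interleaved s \<epsilon> M N \<longleftrightarrow>
     0 \<le> \<epsilon> \<and>
     (\<exists>\<phi> \<psi>.
        (\<forall>a. linear_between s s (obj M a) (obj N (a + \<epsilon>)) (\<phi> a)) \<and>
        (\<forall>a. linear_between s s (obj N a) (obj M (a + \<epsilon>)) (\<psi> a)) \<and>
        (\<forall>a b. a \<le> b \<longrightarrow>
           (\<forall>x\<in>obj M a. \<phi> b (struct M a b x) = struct N (a + \<epsilon>) (b + \<epsilon>) (\<phi> a x))) \<and>
        (\<forall>a b. a \<le> b \<longrightarrow>
           (\<forall>y\<in>obj N a. \<psi> b (struct N a b y) = struct M (a + \<epsilon>) (b + \<epsilon>) (\<psi> a y))) \<and>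
        (\<forall>a. \<forall>x\<in>obj M a. \<psi> (a + \<epsilon>) (\<phi> a x) = struct M a (a + 2 * \<epsilon>) x) \<and>
        (\<forall>a. \<forall>y\<in>obj N a. \<phi> (a + \<epsilon>) (\<psi> a y) = struct N a (a + 2 * \<epsilon>) y))"

definition interleaving_dist ::
    "('k \<Rightarrow> 'v::ab_group_add \<Rightarrow> 'v) \<Rightarrow> 'v pmod \<Rightarrow> 'v pmod \<Rightarrow> ereal" where
  "interleaving_dist s M N = (INF \<epsilon>\<in>{\<epsilon>. interleaved s \<epsilon> M N}. ereal \<epsilon>)"

section \<open>Isomorphism classes\<close>

text \<open>
  All persistence modules are taken inside the ambient space \<open>real \<Rightarrow>\<^sub>0 'k\<close>, of dimension
  \<open>|\<real>|\<close>. Its subspaces represent every vector space of dimension at most \<open>|\<real>|\<close>, so every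
  persistence module with spaces of such dimensions is isomorphic to one in this universe.
  In particular this holds for the modules of each of the collections (cid), (cfid), (pfd)
  and (rid), which are therefore represented in full.
\<close>

type_synonym 'k upmod = "(real \<Rightarrow>\<^sub>0 'k) pmod"

abbreviation uscale :: "'k::field \<Rightarrow> (real \<Rightarrow>\<^sub>0 'k) \<Rightarrow> (real \<Rightarrow>\<^sub>0 'k)" where
  "uscale \<equiv> fs_scale (*)"

definition iso_rel :: "('k::field upmod \<times> 'k upmod) set" where
  "iso_rel = {(M, N). persistence_module uscale M \<and> persistence_module uscale N \<and>
                      isomorphic uscale M uscale N}"

definition pmod_classes :: "'k::field upmod set set" where
  "pmod_classes = {M. persistence_module uscale M} // iso_rel"

definition zero_class :: "'k::field upmod set" where
  "zero_class = iso_rel `` {zero_pmod}"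

text \<open>
  The interleaving distance is invariant under isomorphism, so the infimum is over a single value.
\<close>

definition d_I :: "'k::field upmod set \<Rightarrow> 'k upmod set \<Rightarrow> ereal" where
  "d_I X Y = (INF M\<in>X. INF N\<in>Y. interleaving_dist uscale M N)"

definition interleaving_topology :: "'k::field upmod set set \<Rightarrow> 'k upmod set topology" where
  "interleaving_topology S =
     topology_generated_by {{Y\<in>S. d_I X Y < ereal r} | X r. X \<in> S \<and> 0 < r}"

section \<open>Collections of persistence modules\<close>

definition interval_decomposition ::
    "'i set \<Rightarrow> ('i \<Rightarrow> real set) \<Rightarrow> 'k::field upmod \<Rightarrow> bool" where
  "interval_decomposition A J M \<longleftrightarrow>
     (\<forall>i\<in>A. is_interval (J i) \<and> J i \<noteq> {}) \<and>
     isomorphic uscale M (fs_scale (*)) (direct_sum A (\<lambda>i. interval_pmod (J i)))"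

text \<open>
  Sets of cardinality at most \<open>|\<real>|\<close>, countable sets among them, are up to bijection the subsets
  of \<open>\<real>\<close>; hence index sets are subsets of \<open>\<real>\<close>.
\<close>

definition rid :: "'k::field upmod set set" where
  "rid = {X \<in> pmod_classes. \<exists>M\<in>X. \<exists>(A :: real set) J. interval_decomposition A J M}"

definition cid :: "'k::field upmod set set" where
  "cid = {X \<in> pmod_classes. \<exists>M\<in>X. \<exists>(A :: real set) J.
            countable A \<and> interval_decomposition A J M}"

definition cfid :: "'k::field upmod set set" where
  "cfid = {X \<in> pmod_classes. \<exists>M\<in>X. \<exists>(A :: real set) J.
             countable A \<and> (\<forall>i\<in>A. bounded (J i)) \<and> interval_decomposition A J M}"

definition finite_dim :: "('k::field \<Rightarrow> 'v::ab_group_add \<Rightarrow> 'v) \<Rightarrow> 'v set \<Rightarrow> bool" where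
  "finite_dim s V \<longleftrightarrow> (\<exists>B. finite B \<and> module.span s B = V)"

definition pfd :: "'k::field upmod set set" where
  "pfd = {X \<in> pmod_classes. \<exists>M\<in>X. \<forall>a. finite_dim uscale (obj M a)}"

definition qtame :: "'k::field upmod set set" where
  "qtame = {X \<in> pmod_classes. \<exists>M\<in>X. \<forall>a b. a < b \<longrightarrow>
              finite_dim uscale (struct M a b ` obj M a)}"

definition finite_dist_zero :: "'k::field upmod set set" where
  "finite_dist_zero = {X \<in> pmod_classes. d_I X zero_class < \<infinity>}"

end

theory Submission
  imports Defs
begin

text \<open>
  All the spaces in question contain one and the same uncountable family, and any two of its members
  are far apart. For \<open>S \<subseteq> \<nat>\<close> let \<open>comb S\<close> be the sum of the interval modules on
  \<open>[5n, 5n + 4]\<close> with \<open>n \<in> S\<close>. The intervals have length \<open>4\<close> and gaps of length \<open>1\<close> between them: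
  they are bounded, at most one of them contains a given point, and \<open>comb S\<close> is \<open>3\<close>-interleaved with
  the zero module. Hence the class of \<open>comb S\<close> lies in each of the collections.

  The pairs \<open>a \<le> b\<close> whose structure map is nonzero (\<open>persists\<close>) are enough to tell the combs
  apart. This is an isomorphism invariant, and an interleaving with parameter below \<open>1\<close> can shrink
  the window \<open>[a, b]\<close> by at most \<open>1\<close> at each end (\<open>persists_d_I\<close>). If a module \<open>Y\<close> were at
  distance less than \<open>1\<close> from both \<open>comb S\<close> and \<open>comb T\<close>, with \<open>n \<in> S - T\<close>, then the
  window \<open>[5n, 5n + 4]\<close> of \<open>comb S\<close> would shrink to \<open>[5n + 1, 5n + 3]\<close> in \<open>Y\<close> and to the point
  \<open>5n + 2\<close> in \<open>comb T\<close>, where \<open>comb T\<close> vanishes. So the balls of radius \<open>1\<close> around the combs are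
  pairwise disjoint. They form an uncountable family of disjoint nonempty open sets, and no countable set
  can meet all of them.

  The equality of the two subspaces near zero holds because a module that is
  \<open>\<epsilon>\<close>-interleaved with zero has vanishing structure maps over windows of length \<open>2 * \<epsilon>\<close>, so
  none of its intervals can be longer than that.
\<close>

section \<open>Windows with a nonzero structure map\<close>

definition persists :: "'v::zero pmod \<Rightarrow> real \<Rightarrow> real \<Rightarrow> bool" where
  "persists M a b \<longleftrightarrow> (\<exists>x\<in>obj M a. struct M a b x \<noteq> 0)"

lemma linear_between_mem: "linear_between s s' V W f \<Longrightarrow> x \<in> V \<Longrightarrow> f x \<in> W"
  by (auto simp: linear_between_def)

lemma linear_between_zero:
  assumes "linear_between s s' V W f" "0 \<in> V"
  shows "f 0 = 0"
proof -
  have "f (0 + 0) = f 0 + f 0"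
    using assms unfolding linear_between_def by blast
  then show ?thesis by simp
qed

lemma persistence_module_zero_mem:
  assumes "persistence_module s M"
  shows "0 \<in> obj M a"
proof -
  have "vector_space s" and "module.subspace s (obj M a)"
    using assms by (auto simp: persistence_module_def)
  then interpret vector_space s by simp
  show ?thesis
    using \<open>subspace (obj M a)\<close> by (rule subspace_0)
qed

lemma persistence_module_linear:
  "persistence_module s M \<Longrightarrow> a \<le> b \<Longrightarrow> linear_between s s (obj M a) (obj M b) (struct M a b)"
  by (simp add: persistence_module_def)

lemma persistence_module_comp:
  "persistence_module s M \<Longrightarrow> a \<le> b \<Longrightarrow> b \<le> c \<Longrightarrow> x \<in> obj M a \<Longrightarrow>
    struct M b c (struct M a b x) = struct M a c x"
  by (simp add: persistence_module_def)

lemmas struct_mem = linear_between_mem[OF persistence_module_linear]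
lemmas struct_zero = linear_between_zero[OF persistence_module_linear]

lemma persists_shrink:
  assumes M: "persistence_module s M" and "persists M a b" and "a \<le> a'" "a' \<le> b'" "b' \<le> b"
  shows "persists M a' b'"
proof -
  obtain x where x: "x \<in> obj M a" "struct M a b x \<noteq> 0"
    using assms by (auto simp: persists_def)
  let ?y = "struct M a a' x"
  have y: "?y \<in> obj M a'"
    using struct_mem[OF M] x assms by blast
  have "struct M b' b (struct M a' b' ?y) = struct M a b x"
    using persistence_module_comp[OF M] x(1) assms y by (metis order_trans)
  then have "struct M a' b' ?y \<noteq> 0"
    using x(2) struct_zero[OF M \<open>b' \<le> b\<close>] persistence_module_zero_mem[OF M] by metis
  with y show ?thesis
    by (auto simp: persists_def)
qed

lemma persists_isomorphic:
  assumes iso: "isomorphic s M s' N" and "a \<le> b" and zero: "0 \<in> obj M b"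
    and mem: "\<And>x. x \<in> obj M a \<Longrightarrow> struct M a b x \<in> obj M b"
  shows "persists M a b \<longleftrightarrow> persists N a b"
proof -
  obtain \<phi> where \<phi>: "\<And>c. linear_between s s' (obj M c) (obj N c) (\<phi> c)"
      "\<And>c. bij_betw (\<phi> c) (obj M c) (obj N c)"
    and nat: "\<And>x. x \<in> obj M a \<Longrightarrow> \<phi> b (struct M a b x) = struct N a b (\<phi> a x)"
    using iso \<open>a \<le> b\<close> unfolding isomorphic_def by metis
  have "\<phi> b y = 0 \<longleftrightarrow> y = 0" if "y \<in> obj M b" for y
    using linear_between_zero[OF \<phi>(1) zero] \<phi>(2)[of b] zero that
    unfolding bij_betw_def inj_on_def by metis
  then have "struct N a b (\<phi> a x) \<noteq> 0 \<longleftrightarrow> struct M a b x \<noteq> 0" if "x \<in> obj M a" for x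
    using that mem nat by metis
  moreover have "obj N a = \<phi> a ` obj M a"
    using \<phi>(2) by (auto simp: bij_betw_def)
  ultimately show ?thesis
    by (auto simp: persists_def)
qed

lemma persists_iso_class:
  assumes "X \<in> pmod_classes" "M \<in> X" "N \<in> X" "a \<le> b"
  shows "persists M a b \<longleftrightarrow> persists N a b"
proof -
  obtain R where R: "persistence_module uscale R" "X = iso_rel `` {R}"
    using assms(1) by (auto simp: pmod_classes_def quotient_def)
  have "isomorphic uscale R uscale M" "isomorphic uscale R uscale N"
    using R assms by (auto simp: iso_rel_def)
  then show ?thesis
    using persists_isomorphic[OF _ \<open>a \<le> b\<close>] persistence_module_zero_mem[OF R(1)]
      struct_mem[OF R(1) \<open>a \<le> b\<close>] by metis
qed

lemma pmod_class_member:
  "X \<in> pmod_classes \<Longrightarrow> M \<in> X \<Longrightarrow> persistence_module uscale M"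
  by (auto simp: pmod_classes_def quotient_def iso_rel_def)

section \<open>Interleavings move windows\<close>

lemma interleaved_refl: "persistence_module s M \<Longrightarrow> interleaved s 0 M M"
  unfolding interleaved_def persistence_module_def
  by (intro conjI exI[of _ "\<lambda>_. id"]) (auto simp: linear_between_def)

lemma interleaved_sym: "interleaved s \<epsilon> M N \<Longrightarrow> interleaved s \<epsilon> N M"
  unfolding interleaved_def by blast

text \<open>
  The structure map of \<open>M\<close> over \<open>[a, b]\<close> equals \<open>M(a) \<rightarrow> N(a + \<epsilon>) \<rightarrow> N(b - \<epsilon>) \<rightarrow> M(b)\<close>, so the
  middle arrow is nonzero whenever the composite is.
\<close>

lemma persists_interleaved:
  assumes M: "persistence_module s M" and N: "persistence_module s N"
    and il: "interleaved s \<epsilon> M N"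
    and pers: "persists M a b" and ab: "a + 2 * \<epsilon> \<le> b"
  shows "persists N (a + \<epsilon>) (b - \<epsilon>)"
proof -
  have "0 \<le> \<epsilon>"
    using il by (simp add: interleaved_def)
  obtain \<phi> \<psi> where
      \<phi>: "\<And>a. linear_between s s (obj M a) (obj N (a + \<epsilon>)) (\<phi> a)"
    and \<psi>: "\<And>a. linear_between s s (obj N a) (obj M (a + \<epsilon>)) (\<psi> a)"
    and nat: "\<And>a b y. a \<le> b \<Longrightarrow> y \<in> obj N a \<Longrightarrow>
                \<psi> b (struct N a b y) = struct M (a + \<epsilon>) (b + \<epsilon>) (\<psi> a y)"
    and comp: "\<And>a x. x \<in> obj M a \<Longrightarrow> \<psi> (a + \<epsilon>) (\<phi> a x) = struct M a (a + 2 * \<epsilon>) x"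
    using il unfolding interleaved_def by metis
  obtain x where x: "x \<in> obj M a" "struct M a b x \<noteq> 0"
    using pers by (auto simp: persists_def)
  have y: "\<phi> a x \<in> obj N (a + \<epsilon>)"
    using linear_between_mem[OF \<phi>] x by blast
  have "\<psi> (b - \<epsilon>) (struct N (a + \<epsilon>) (b - \<epsilon>) (\<phi> a x)) = struct M (a + 2 * \<epsilon>) b (\<psi> (a + \<epsilon>) (\<phi> a x))"
    using nat[OF _ y, of "b - \<epsilon>"] ab by (simp add: algebra_simps)
  also have "\<dots> = struct M a b x"
    using comp x persistence_module_comp[OF M] ab \<open>0 \<le> \<epsilon>\<close> by simp
  finally have "struct N (a + \<epsilon>) (b - \<epsilon>) (\<phi> a x) \<noteq> 0"
    using x(2) linear_between_zero[OF \<psi>] persistence_module_zero_mem[OF N] by metis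
  with y show ?thesis
    by (auto simp: persists_def)
qed

lemma d_I_lessE:
  assumes "d_I X Y < ereal r"
  obtains M N \<epsilon> where "M \<in> X" "N \<in> Y" "interleaved uscale \<epsilon> M N" "\<epsilon> < r"
  using assms unfolding d_I_def interleaving_dist_def INF_less_iff by auto

lemma d_I_le:
  assumes "M \<in> X" "N \<in> Y" "interleaved uscale \<epsilon> M N"
  shows "d_I X Y \<le> ereal \<epsilon>"
  unfolding d_I_def interleaving_dist_def
  by (intro INF_lower2[OF assms(1)] INF_lower2[OF assms(2)] INF_lower) (use assms(3) in simp)

text \<open>
  The infimum in \<open>d_I\<close> need not be attained, nor attained at the given representatives. The
  window is therefore first moved by some \<open>\<epsilon> < r\<close> and then shrunk to the one for \<open>r\<close>, and
  both ends of the move are transported along isomorphisms.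
\<close>

lemma persists_d_I:
  assumes X: "X \<in> pmod_classes" and Y: "Y \<in> pmod_classes"
    and dist: "d_I X Y < ereal r \<or> d_I Y X < ereal r"
    and M: "M \<in> X" and N: "N \<in> Y" and pers: "persists M a b" and ab: "a + 2 * r \<le> b"
  shows "persists N (a + r) (b - r)"
proof -
  obtain M' N' \<epsilon> where *: "M' \<in> X" "N' \<in> Y" "interleaved uscale \<epsilon> M' N'" "\<epsilon> < r"
    using dist
  proof
    assume "d_I X Y < ereal r"
    then show ?thesis
      by (rule d_I_lessE) (use that in auto)
  next
    assume "d_I Y X < ereal r"
    then show ?thesis
      by (rule d_I_lessE) (use that in \<open>blast intro: interleaved_sym\<close>)
  qed
  note M' = pmod_class_member[OF X \<open>M' \<in> X\<close>] and N' = pmod_class_member[OF Y \<open>N' \<in> Y\<close>]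
  have "0 \<le> \<epsilon>"
    using *(3) by (simp add: interleaved_def)
  then have "persists M' a b"
    using persists_iso_class[OF X M \<open>M' \<in> X\<close>] pers ab * by simp
  then have "persists N' (a + \<epsilon>) (b - \<epsilon>)"
    using persists_interleaved[OF M' N'] * ab by simp
  then have "persists N' (a + r) (b - r)"
    by (rule persists_shrink[OF N']) (use * ab in auto)
  then show ?thesis
    using persists_iso_class[OF Y \<open>N' \<in> Y\<close> N] ab by simp
qed

section \<open>Sums of interval modules\<close>

lemma lookup_fs_scale:
  fixes f :: "'i \<Rightarrow>\<^sub>0 'k::field"
  shows "Poly_Mapping.lookup (fs_scale (*) c f) i = c * Poly_Mapping.lookup f i"
  by (simp add: fs_scale_def map.rep_eq when_def)

lemma vector_space_fs_scale: "vector_space (fs_scale (*) :: 'k::field \<Rightarrow> ('i \<Rightarrow>\<^sub>0 'k) \<Rightarrow> _)"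
  by unfold_locales (auto intro!: poly_mapping_eqI simp: lookup_fs_scale lookup_add algebra_simps)

interpretation fs: vector_space "fs_scale (*) :: 'k::field \<Rightarrow> ('i \<Rightarrow>\<^sub>0 'k) \<Rightarrow> _"
  by (rule vector_space_fs_scale)

abbreviation interval_sum :: "'i set \<Rightarrow> ('i \<Rightarrow> real set) \<Rightarrow> ('i \<Rightarrow>\<^sub>0 'k::field) pmod" where
  "interval_sum A J \<equiv> direct_sum A (\<lambda>i. interval_pmod (J i))"

lemma obj_interval_sum:
  "obj (interval_sum A J) a = {f. \<forall>i. Poly_Mapping.lookup f i \<noteq> 0 \<longrightarrow> i \<in> A \<and> a \<in> J i}"
  by (auto simp: direct_sum_def interval_pmod_def in_keys_iff split: if_splits)

lemma lookup_struct_interval_sum: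
  "Poly_Mapping.lookup (struct (interval_sum A J) a b f) i
    = (if a \<in> J i \<and> b \<in> J i then Poly_Mapping.lookup f i else 0)"
  by (simp add: direct_sum_def interval_pmod_def lookup_mapp when_def in_keys_iff)

lemma subspace_obj_interval_sum:
  "fs.subspace (obj (interval_sum A J :: ('i \<Rightarrow>\<^sub>0 'k::field) pmod) a)"
  unfolding fs.subspace_def obj_interval_sum
  by (auto simp: lookup_add lookup_fs_scale) (metis add_0)+

lemma linear_struct_interval_sum:
  "linear_between (fs_scale (*)) (fs_scale (*)) (obj (interval_sum A J) a) (obj (interval_sum A J) b)
     (struct (interval_sum A J :: ('i \<Rightarrow>\<^sub>0 'k::field) pmod) a b)"
  unfolding linear_between_def
  by (auto intro!: poly_mapping_eqI simp: obj_interval_sum lookup_struct_interval_sum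
      lookup_add lookup_fs_scale split: if_splits)

text \<open>
  Functoriality is where convexity enters: a family that is nonzero at \<open>a\<close> and at \<open>c\<close> must not be
  killed by passing through a point \<open>b\<close> between them.
\<close>

lemma persistence_module_interval_sum:
  assumes "\<And>i. i \<in> A \<Longrightarrow> is_interval (J i)"
  shows "persistence_module (fs_scale (*)) (interval_sum A J :: ('i \<Rightarrow>\<^sub>0 'k::field) pmod)"
  unfolding persistence_module_def
proof (intro conjI allI impI ballI)
  fix a b c and x :: "'i \<Rightarrow>\<^sub>0 'k"
  assume "a \<le> b" "b \<le> c" and x: "x \<in> obj (interval_sum A J) a"
  then have "b \<in> J i" if "i \<in> A" "a \<in> J i" "c \<in> J i" for i
    using assms[OF that(1)] that by (meson mem_is_interval_1_I)
  then show "struct (interval_sum A J) b c (struct (interval_sum A J) a b x)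
      = struct (interval_sum A J) a c x"
    using x by (intro poly_mapping_eqI) (auto simp: lookup_struct_interval_sum obj_interval_sum)
next
  fix a and x :: "'i \<Rightarrow>\<^sub>0 'k"
  assume "x \<in> obj (interval_sum A J) a"
  then show "struct (interval_sum A J) a a x = x"
    by (intro poly_mapping_eqI) (auto simp: lookup_struct_interval_sum obj_interval_sum)
qed (auto intro: vector_space_fs_scale subspace_obj_interval_sum linear_struct_interval_sum)

lemma persists_interval_sum:
  "persists (interval_sum A J :: ('i \<Rightarrow>\<^sub>0 'k::field) pmod) a b \<longleftrightarrow> (\<exists>i\<in>A. a \<in> J i \<and> b \<in> J i)"
proof
  assume "persists (interval_sum A J :: ('i \<Rightarrow>\<^sub>0 'k) pmod) a b"
  then obtain x :: "'i \<Rightarrow>\<^sub>0 'k" where "x \<in> obj (interval_sum A J) a"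
      "struct (interval_sum A J) a b x \<noteq> 0"
    by (auto simp: persists_def)
  then obtain i where "Poly_Mapping.lookup (struct (interval_sum A J) a b x) i \<noteq> 0"
    by (metis poly_mapping_eqI lookup_zero)
  with \<open>x \<in> _\<close> show "\<exists>i\<in>A. a \<in> J i \<and> b \<in> J i"
    by (auto simp: lookup_struct_interval_sum obj_interval_sum split: if_splits)
next
  assume "\<exists>i\<in>A. a \<in> J i \<and> b \<in> J i"
  then obtain i where i: "i \<in> A" "a \<in> J i" "b \<in> J i" by blast
  let ?x = "Poly_Mapping.single i (1::'k)"
  have "?x \<in> obj (interval_sum A J) a"
    using i by (auto simp: obj_interval_sum lookup_single when_def)
  moreover have "Poly_Mapping.lookup (struct (interval_sum A J) a b ?x) i \<noteq> Poly_Mapping.lookup 0 i"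
    using i by (simp add: lookup_struct_interval_sum)
  then have "struct (interval_sum A J) a b ?x \<noteq> 0"
    by metis
  ultimately show "persists (interval_sum A J :: ('i \<Rightarrow>\<^sub>0 'k) pmod) a b"
    by (auto simp: persists_def)
qed

lemma obj_interval_sum_span:
  "obj (interval_sum A J :: ('i \<Rightarrow>\<^sub>0 'k::field) pmod) a
     \<subseteq> fs.span ((\<lambda>i. Poly_Mapping.single i 1) ` {i\<in>A. a \<in> J i})"
proof
  fix x :: "'i \<Rightarrow>\<^sub>0 'k"
  assume x: "x \<in> obj (interval_sum A J) a"
  have "x = (\<Sum>i\<in>Poly_Mapping.keys x. fs_scale (*) (Poly_Mapping.lookup x i) (Poly_Mapping.single i 1))"
    by (intro poly_mapping_eqI)
      (auto simp: lookup_sum lookup_fs_scale lookup_single when_def in_keys_iff if_distrib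
        cong: if_cong)
  also have "\<dots> \<in> fs.span ((\<lambda>i. Poly_Mapping.single i 1) ` {i\<in>A. a \<in> J i})"
    using x by (intro fs.span_sum fs.span_scale fs.span_base) (auto simp: obj_interval_sum in_keys_iff)
  finally show "x \<in> fs.span ((\<lambda>i. Poly_Mapping.single i 1) ` {i\<in>A. a \<in> J i})" .
qed

lemma finite_dim_subspace:
  fixes V :: "('i \<Rightarrow>\<^sub>0 'k::field) set"
  assumes "fs.subspace V" "V \<subseteq> fs.span B" "finite B"
  shows "finite_dim (fs_scale (*)) V"
proof -
  obtain C where C: "C \<subseteq> V" "fs.independent C" "V \<subseteq> fs.span C"
    by (rule fs.maximal_independent_subset)
  have "finite C"
    using fs.independent_span_bound[OF \<open>finite B\<close> C(2)] C(1) assms(2) by blast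
  moreover have "fs.span C = V"
    using C assms(1) by (simp add: fs.span_minimal subset_antisym)
  ultimately show ?thesis
    unfolding finite_dim_def by blast
qed

lemma subspace_image_linear_between:
  fixes V :: "('i \<Rightarrow>\<^sub>0 'k::field) set"
  assumes "fs.subspace V" "linear_between (fs_scale (*)) (fs_scale (*)) V W f"
  shows "fs.subspace (f ` V)"
  unfolding fs.subspace_def
proof (intro conjI ballI allI)
  have "0 \<in> V" using assms(1) by (rule fs.subspace_0)
  then show "0 \<in> f ` V"
    using linear_between_zero[OF assms(2)] by force
next
  fix x y assume "x \<in> f ` V" "y \<in> f ` V"
  then obtain u v where uv: "u \<in> V" "v \<in> V" "x = f u" "y = f v" by auto
  then have "x + y = f (u + v)"
    using assms(2) by (simp add: linear_between_def)
  then show "x + y \<in> f ` V"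
    using fs.subspace_add[OF assms(1)] uv by simp
next
  fix c x assume "x \<in> f ` V"
  then obtain u where u: "u \<in> V" "x = f u" by auto
  then have "fs_scale (*) c x = f (fs_scale (*) c u)"
    using assms(2) by (simp add: linear_between_def)
  then show "fs_scale (*) c x \<in> f ` V"
    using fs.subspace_scale[OF assms(1)] u by simp
qed

section \<open>Modules at finite distance from zero\<close>

lemma isomorphic_refl: "isomorphic s M s M"
  unfolding isomorphic_def
  by (rule exI[of _ "\<lambda>_. id"]) (auto simp: linear_between_def)

lemma persistence_module_zero_pmod: "persistence_module uscale (zero_pmod :: 'k::field upmod)"
  by (auto simp: persistence_module_def zero_pmod_def linear_between_def vector_space_fs_scale
      intro: fs.subspace_single_0)

lemma zero_pmod_in_zero_class: "zero_pmod \<in> zero_class"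
  by (simp add: zero_class_def iso_rel_def persistence_module_zero_pmod isomorphic_refl)

lemma zero_class_in_pmod_classes: "(zero_class :: 'k::field upmod set) \<in> pmod_classes"
  by (simp add: zero_class_def pmod_classes_def quotientI persistence_module_zero_pmod)

lemma interleaved_zero_pmod:
  assumes M: "persistence_module uscale (M :: 'k::field upmod)" and "0 \<le> \<epsilon>"
    and null: "\<And>a. \<not> persists M a (a + 2 * \<epsilon>)"
  shows "interleaved uscale \<epsilon> M zero_pmod"
  unfolding interleaved_def
proof (intro conjI exI[of _ "\<lambda>_ _. 0"] allI impI ballI)
  show "linear_between uscale uscale (obj zero_pmod a) (obj M (a + \<epsilon>)) (\<lambda>_. 0)" for a
    using persistence_module_zero_mem[OF M] fs.scale_zero_right
    by (auto simp: linear_between_def)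
  show "0 = struct M (a + \<epsilon>) (b + \<epsilon>) 0" if "a \<le> b" for a b
    using struct_zero[OF M] persistence_module_zero_mem[OF M] that by simp
  show "0 = struct M a (a + 2 * \<epsilon>) x" if "x \<in> obj M a" for a x
    using null that by (auto simp: persists_def)
qed (use \<open>0 \<le> \<epsilon>\<close> fs.scale_zero_right in \<open>auto simp: linear_between_def zero_pmod_def\<close>)

lemma bounded_interval_if_no_long_window:
  fixes I :: "real set"
  assumes I: "is_interval I" and "0 \<le> c" and no: "\<And>a. \<not> (a \<in> I \<and> a + c \<in> I)"
  shows "bounded I"
proof (cases "I = {}")
  case False
  then obtain x where x: "x \<in> I" by blast
  have "I \<subseteq> {x - c..x + c}"
  proof
    fix y assume y: "y \<in> I"
    have "\<not> x + c < y"
      using mem_is_interval_1_I[OF I x y, of "x + c"] no[of x] x \<open>0 \<le> c\<close> by auto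
    moreover have "\<not> y < x - c"
      using mem_is_interval_1_I[OF I y x, of "y + c"] no[of y] y \<open>0 \<le> c\<close> by auto
    ultimately show "y \<in> {x - c..x + c}" by simp
  qed
  then show ?thesis
    by (rule bounded_subset[OF bounded_closed_interval])
qed simp

text \<open>
  A distance below \<open>r\<close> to zero moves every window of length \<open>2 * r\<close> to one of the zero module,
  where nothing persists; but both ends of such a window fit into any interval longer than \<open>2 * r\<close>.
\<close>

lemma bounded_intervals_if_finite_dist_zero:
  assumes X: "X \<in> finite_dist_zero" and M: "M \<in> X" and dec: "interval_decomposition A J M"
    and i: "i \<in> A"
  shows "bounded (J i)"
proof -
  have X': "X \<in> pmod_classes" and "d_I X zero_class < \<infinity>"
    using X by (auto simp: finite_dist_zero_def)
  then obtain r where "d_I X zero_class < ereal r"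
    using less_PInf_Ex_of_nat by (metis less_irrefl)
  then obtain \<epsilon> where "\<epsilon> < r" "0 \<le> \<epsilon>"
    by (auto elim!: d_I_lessE simp: interleaved_def)
  then have "0 \<le> r" by simp
  have null: "\<not> persists M a (a + 2 * r)" for a
  proof
    assume "persists M a (a + 2 * r)"
    then have "persists (zero_pmod :: 'a upmod) (a + r) (a + 2 * r - r)"
      by (rule persists_d_I[OF X' zero_class_in_pmod_classes
            disjI1[OF \<open>d_I X zero_class < ereal r\<close>] M zero_pmod_in_zero_class]) simp
    then show False
      by (simp add: persists_def zero_pmod_def)
  qed
  note PM = pmod_class_member[OF X' M]
  have iso: "isomorphic uscale M (fs_scale (*)) (interval_sum A J)"
    and int: "is_interval (J i)"
    using dec i by (auto simp: interval_decomposition_def)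
  have "\<not> persists (interval_sum A J :: ('b \<Rightarrow>\<^sub>0 'a) pmod) a (a + 2 * r)" for a
    using persists_isomorphic[OF iso, of a "a + 2 * r"] null[of a] \<open>0 \<le> r\<close>
      persistence_module_zero_mem[OF PM] struct_mem[OF PM] by auto
  then have "\<not> (a \<in> J i \<and> a + 2 * r \<in> J i)" for a
    using i unfolding persists_interval_sum by blast
  then show ?thesis
    using bounded_interval_if_no_long_window[OF int, of "2 * r"] \<open>0 \<le> r\<close> by simp
qed

lemma cid_finite_dist_zero_eq_cfid:
  "(cid \<inter> finite_dist_zero :: 'k::field upmod set set) = cfid \<inter> finite_dist_zero"
proof
  show "(cid \<inter> finite_dist_zero :: 'k upmod set set) \<subseteq> cfid \<inter> finite_dist_zero"
  proof
    fix X :: "'k upmod set"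
    assume X: "X \<in> cid \<inter> finite_dist_zero"
    then have "\<exists>M\<in>X. \<exists>(A :: real set) J. countable A \<and> interval_decomposition A J M"
      unfolding cid_def by blast
    then obtain M J and A :: "real set" where MX: "M \<in> X" and A: "countable A"
      and dec: "interval_decomposition A J M"
      by (elim bexE exE conjE)
    have "\<forall>i\<in>A. bounded (J i)"
      using bounded_intervals_if_finite_dist_zero[OF IntD2[OF X] MX dec] by simp
    with A dec have "\<exists>(A :: real set) J. countable A \<and> (\<forall>i\<in>A. bounded (J i)) \<and>
        interval_decomposition A J M"
      by (intro exI[of _ A] exI[of _ J] conjI)
    then show "X \<in> cfid \<inter> finite_dist_zero"
      using X MX by (auto simp: cfid_def cid_def)
  qed
  show "(cfid \<inter> finite_dist_zero :: 'k upmod set set) \<subseteq> cid \<inter> finite_dist_zero"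
    by (auto simp: cfid_def cid_def)
qed

section \<open>The comb modules\<close>

text \<open>
  The index set of the sum is a set of reals, so that the module lies in the universe \<open>real \<Rightarrow>\<^sub>0 'k\<close>.
\<close>

definition comb :: "nat set \<Rightarrow> 'k::field upmod" where
  "comb S = interval_sum (real ` S) (\<lambda>t. {5 * t..5 * t + 4})"

definition comb_class :: "nat set \<Rightarrow> 'k::field upmod set" where
  "comb_class S = iso_rel `` {comb S}"

lemma persistence_module_comb: "persistence_module uscale (comb S)"
  unfolding comb_def by (rule persistence_module_interval_sum) simp

lemma comb_in_comb_class: "comb S \<in> comb_class S"
  by (simp add: comb_class_def iso_rel_def persistence_module_comb isomorphic_refl)

lemma comb_class_in_pmod_classes: "(comb_class S :: 'k::field upmod set) \<in> pmod_classes"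
  by (simp add: comb_class_def pmod_classes_def quotientI persistence_module_comb)

lemma comb_class_cfid: "(comb_class S :: 'k::field upmod set) \<in> cfid"
proof -
  let ?J = "\<lambda>t::real. {5 * t..5 * t + 4}"
  have "interval_decomposition (real ` S) ?J (comb S :: 'k upmod)"
    by (auto simp: interval_decomposition_def comb_def isomorphic_refl)
  moreover have "countable (real ` S)" "\<forall>t\<in>real ` S. bounded (?J t)"
    by auto
  ultimately have "\<exists>(A :: real set) J. countable A \<and> (\<forall>i\<in>A. bounded (J i)) \<and>
      interval_decomposition A J (comb S :: 'k upmod)"
    by (intro exI[of _ "real ` S"] exI[of _ ?J] conjI)
  then show ?thesis
    using comb_class_in_pmod_classes comb_in_comb_class unfolding cfid_def by blast
qed

lemma cfid_subset_cid: "cfid \<subseteq> cid"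
  by (auto simp: cfid_def cid_def)

lemma cid_subset_rid: "cid \<subseteq> rid"
  by (auto simp: cid_def rid_def)

text \<open>
  Pointwise finite dimension and q-tameness are both read off from this bound. It holds because the
  intervals are disjoint: the only one that can contain \<open>a\<close> is the one starting at \<open>5 * \<lfloor>a / 5\<rfloor>\<close>.
\<close>

lemma obj_comb_span:
  obtains B where "finite B" "obj (comb S :: 'k::field upmod) a \<subseteq> fs.span B"
proof -
  let ?K = "{t \<in> real ` S. a \<in> {5 * t..5 * t + 4}}"
  have "?K \<subseteq> {real (nat \<lfloor>a / 5\<rfloor>)}"
  proof
    fix t assume "t \<in> ?K"
    then obtain n where n: "t = real n" "5 * real n \<le> a" "a \<le> 5 * real n + 4" by auto
    then have "\<lfloor>a / 5\<rfloor> = int n"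
      by (intro floor_unique) auto
    with n show "t \<in> {real (nat \<lfloor>a / 5\<rfloor>)}" by simp
  qed
  then have "finite ?K"
    by (rule finite_subset) simp
  then show ?thesis
    by (rule that[OF finite_imageI]) (unfold comb_def, rule obj_interval_sum_span)
qed

lemma comb_class_pfd: "(comb_class S :: 'k::field upmod set) \<in> pfd"
proof -
  have "finite_dim uscale (obj (comb S :: 'k upmod) a)" for a
  proof -
    obtain B where "finite B" "obj (comb S :: 'k upmod) a \<subseteq> fs.span B"
      by (rule obj_comb_span)
    moreover have "fs.subspace (obj (comb S :: 'k upmod) a)"
      unfolding comb_def by (rule subspace_obj_interval_sum)
    ultimately show ?thesis
      by (intro finite_dim_subspace)
  qed
  then show ?thesis
    using comb_class_in_pmod_classes comb_in_comb_class unfolding pfd_def by blast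
qed

lemma comb_class_qtame: "(comb_class S :: 'k::field upmod set) \<in> qtame"
proof -
  have "finite_dim uscale (struct (comb S) a b ` obj (comb S :: 'k upmod) a)" if "a < b" for a b
  proof -
    let ?f = "struct (comb S :: 'k upmod) a b"
    have lin: "linear_between uscale uscale (obj (comb S) a) (obj (comb S) b) ?f"
      by (rule persistence_module_linear[OF persistence_module_comb less_imp_le[OF that]])
    obtain B where B: "finite B" "obj (comb S :: 'k upmod) b \<subseteq> fs.span B"
      by (rule obj_comb_span)
    have "?f ` obj (comb S) a \<subseteq> fs.span B"
      using lin B(2) by (auto simp: linear_between_def)
    moreover have "fs.subspace (?f ` obj (comb S) a)"
      by (rule subspace_image_linear_between[OF _ lin])
        (unfold comb_def, rule subspace_obj_interval_sum)
    ultimately show ?thesis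
      using B(1) by (intro finite_dim_subspace)
  qed
  then show ?thesis
    using comb_class_in_pmod_classes comb_in_comb_class unfolding qtame_def by blast
qed

lemma comb_class_finite_dist_zero: "(comb_class S :: 'k::field upmod set) \<in> finite_dist_zero"
proof -
  (* A window of length 2 * 3 is longer than the intervals, whose length is 4. *)
  have "interleaved uscale 3 (comb S :: 'k upmod) zero_pmod"
    by (rule interleaved_zero_pmod[OF persistence_module_comb])
      (auto simp: comb_def persists_interval_sum)
  then have "d_I (comb_class S :: 'k upmod set) zero_class \<le> ereal 3"
    using d_I_le comb_in_comb_class zero_pmod_in_zero_class by blast
  then have "d_I (comb_class S :: 'k upmod set) zero_class < \<infinity>"
    by (rule order_le_less_trans) simp
  then show ?thesis
    by (simp add: finite_dist_zero_def comb_class_in_pmod_classes)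
qed

lemma d_I_comb_class_self: "d_I (comb_class S :: 'k::field upmod set) (comb_class S) < ereal 1"
proof -
  have "interleaved uscale 0 (comb S :: 'k upmod) (comb S)"
    by (rule interleaved_refl[OF persistence_module_comb])
  then have "d_I (comb_class S :: 'k upmod set) (comb_class S) \<le> ereal 0"
    using d_I_le comb_in_comb_class by blast
  then show ?thesis
    by (rule order_le_less_trans) simp
qed

text \<open>
  The window \<open>[5n, 5n + 4]\<close> of the first comb loses \<open>1\<close> at each end on the way to \<open>Y\<close> and again
  on the way to the second comb. Its length \<open>4\<close> is just enough for the midpoint \<open>5n + 2\<close> to
  survive, and the interval of the second comb that contains this midpoint is the \<open>n\<close>-th one. With
  the two combs exchanged, this gives equality, so \<open>Y\<close> lies in the ball of at most one comb.
\<close>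

lemma comb_balls_determine_teeth:
  fixes Y :: "'k::field upmod set"
  assumes Y: "Y \<in> pmod_classes"
    and S: "d_I (comb_class S) Y < ereal 1" and T: "d_I (comb_class T) Y < ereal 1"
  shows "S \<subseteq> T"
proof
  fix n assume n: "n \<in> S"
  define a where "a = 5 * real n"
  obtain N where N: "N \<in> Y"
    using S by (auto elim: d_I_lessE)
  have "persists (comb S :: 'k upmod) a (a + 4)"
    using n by (auto simp: comb_def persists_interval_sum a_def)
  then have "persists N (a + 1) (a + 4 - 1)"
    by (rule persists_d_I[OF comb_class_in_pmod_classes Y disjI1[OF S] comb_in_comb_class N]) simp
  then have "persists (comb T :: 'k upmod) (a + 1 + 1) (a + 4 - 1 - 1)"
    by (rule persists_d_I[OF Y comb_class_in_pmod_classes disjI2[OF T] N comb_in_comb_class]) simp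
  then obtain m where "m \<in> T" "5 * real m \<le> 5 * real n + 2" "5 * real n + 2 \<le> 5 * real m + 4"
    by (auto simp: comb_def persists_interval_sum a_def)
  then have "m = n" by linarith
  with \<open>m \<in> T\<close> show "n \<in> T" by simp
qed

section \<open>Nonseparability\<close>

lemma uncountable_disjoint_open_imp_not_separable:
  assumes "uncountable I" and U: "\<And>i. i \<in> I \<Longrightarrow> openin X (U i) \<and> U i \<noteq> {}"
    and disj: "disjoint_family_on U I"
  shows "\<not> separable_space X"
proof
  assume "separable_space X"
  then obtain C where C: "countable C" "X closure_of C = topspace X"
    unfolding separable_space_def by blast
  have "C \<inter> U i \<noteq> {}" if "i \<in> I" for i
    using C(2) U[OF that] by (simp add: dense_intersects_open)
  then have "\<forall>i\<in>I. \<exists>c. c \<in> C \<inter> U i"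
    by blast
  then obtain c where c: "\<And>i. i \<in> I \<Longrightarrow> c i \<in> C \<inter> U i"
    by metis
  have "inj_on c I"
    using c disj by (fastforce simp: inj_on_def disjoint_family_on_def)
  moreover have "countable (c ` I)"
    using C(1) c by (auto intro: countable_subset)
  ultimately show False
    using \<open>uncountable I\<close> countable_image_inj_on by blast
qed

lemma uncountable_UNIV_nat_set: "uncountable (UNIV :: nat set set)"
proof
  assume "countable (UNIV :: nat set set)"
  then have "range (from_nat_into (UNIV :: nat set set)) = Pow UNIV"
    by (simp add: range_from_nat_into)
  with Cantors_theorem show False by blast
qed

text \<open>
  A subspace topology and the topology generated by balls centred in the subset are different
  constructions: in the former the centres may lie anywhere in \<open>\<S>\<close>. The case \<open>\<D> = \<S>\<close> gives back
  the latter.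
\<close>

lemma not_separable_if_combs:
  fixes \<S> \<D> :: "'k::field upmod set set"
  assumes sub: "\<D> \<subseteq> \<S>" "\<S> \<subseteq> pmod_classes" and combs: "range comb_class \<subseteq> \<D>"
  shows "\<not> separable_space (subtopology (interleaving_topology \<S>) \<D>)"
proof (rule uncountable_disjoint_open_imp_not_separable[OF uncountable_UNIV_nat_set])
  let ?B = "\<lambda>S. {Y\<in>\<S>. d_I (comb_class S) Y < ereal 1}"
  fix S :: "nat set"
  have "comb_class S \<in> \<S>"
    using sub combs by blast
  then have "openin (interleaving_topology \<S>) (?B S)"
    unfolding interleaving_topology_def
    by (intro topology_generated_by_Basis) (use zero_less_one in blast)
  moreover have "comb_class S \<in> ?B S \<inter> \<D>"
    using combs \<open>comb_class S \<in> \<S>\<close> d_I_comb_class_self by blast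
  ultimately show "openin (subtopology (interleaving_topology \<S>) \<D>) (?B S \<inter> \<D>) \<and> ?B S \<inter> \<D> \<noteq> {}"
    by (blast intro: openin_subtopology_Int)
next
  show "disjoint_family_on (\<lambda>S. {Y\<in>\<S>. d_I (comb_class S) Y < ereal 1} \<inter> \<D>) UNIV"
    unfolding disjoint_family_on_def
  proof (intro ballI impI equals0I)
    fix S T :: "nat set" and Y
    assume "S \<noteq> T" and "Y \<in> {Y\<in>\<S>. d_I (comb_class S) Y < ereal 1} \<inter> \<D>
        \<inter> ({Y\<in>\<S>. d_I (comb_class T) Y < ereal 1} \<inter> \<D>)"
    then have Y: "Y \<in> pmod_classes" "d_I (comb_class S) Y < ereal 1" "d_I (comb_class T) Y < ereal 1"
      using sub by auto
    then have "S = T"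
      using comb_balls_determine_teeth[OF Y(1)] by blast
    with \<open>S \<noteq> T\<close> show False ..
  qed
qed

corollary not_separable_if_combs_whole:
  fixes \<S> :: "'k::field upmod set set"
  assumes "\<S> \<subseteq> pmod_classes" "range comb_class \<subseteq> \<S>"
  shows "\<not> separable_space (interleaving_topology \<S>)"
proof -
  have "topspace (interleaving_topology \<S>) \<subseteq> \<S>"
    by (auto simp: interleaving_topology_def)
  then have "subtopology (interleaving_topology \<S>) \<S> = interleaving_topology \<S>"
    by (rule subtopology_superset)
  then show ?thesis
    using not_separable_if_combs[OF subset_refl assms] by simp
qed

theorem theorem4p20:
  shows "\<not> separable_space (interleaving_topology (cfid :: 'k::field upmod set set)) \<and>
         \<not> separable_space (interleaving_topology (cid :: 'k upmod set set)) \<and>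
         \<not> separable_space (interleaving_topology (pfd :: 'k upmod set set)) \<and>
         \<not> separable_space (interleaving_topology (rid :: 'k upmod set set)) \<and>
         \<not> separable_space
              (subtopology (interleaving_topology (cid :: 'k upmod set set)) (cid \<inter> finite_dist_zero)) \<and>
         (cid \<inter> finite_dist_zero :: 'k upmod set set) = cfid \<inter> finite_dist_zero \<and>
         \<not> separable_space (interleaving_topology (cid \<inter> qtame :: 'k upmod set set)) \<and>
         \<not> separable_space (interleaving_topology (cfid \<inter> qtame :: 'k upmod set set))"
proof -
  have cfid: "(cfid :: 'k upmod set set) \<subseteq> pmod_classes"
    and cid: "(cid :: 'k upmod set set) \<subseteq> pmod_classes"
    and pfd: "(pfd :: 'k upmod set set) \<subseteq> pmod_classes"
    and rid: "(rid :: 'k upmod set set) \<subseteq> pmod_classes"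
    by (auto simp: cfid_def cid_def pfd_def rid_def)
  have combs: "range comb_class \<subseteq> (cfid :: 'k upmod set set)"
    "range comb_class \<subseteq> (cid :: 'k upmod set set)"
    "range comb_class \<subseteq> (pfd :: 'k upmod set set)"
    "range comb_class \<subseteq> (rid :: 'k upmod set set)"
    "range comb_class \<subseteq> (cid \<inter> finite_dist_zero :: 'k upmod set set)"
    "range comb_class \<subseteq> (cid \<inter> qtame :: 'k upmod set set)"
    "range comb_class \<subseteq> (cfid \<inter> qtame :: 'k upmod set set)"
    by (simp_all add: image_subset_iff comb_class_cfid comb_class_pfd comb_class_qtame
        comb_class_finite_dist_zero subsetD[OF cfid_subset_cid] subsetD[OF cid_subset_rid])
  show ?thesis
    using not_separable_if_combs_whole[OF cfid combs(1)]
      not_separable_if_combs_whole[OF cid combs(2)]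
      not_separable_if_combs_whole[OF pfd combs(3)]
      not_separable_if_combs_whole[OF rid combs(4)]
      not_separable_if_combs[OF Int_lower1 cid combs(5)]
      cid_finite_dist_zero_eq_cfid
      not_separable_if_combs_whole[OF le_infI1[OF cid] combs(6)]
      not_separable_if_combs_whole[OF le_infI1[OF cfid] combs(7)]
    by (intro conjI)
qed

end
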